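(* Let $g=(g_{\mathrm q},g_{\mathrm p}):\mathbb{R}^{2n}\to\mathbb{R}^{2n}$ be continuously differentiable with Lipschitz-continuous derivative and let the origin be an asymptotically stable equilibrium of $z^+(t)=g(z(t))$, $t\in I$, with flow $\varphi_t$. Suppose that the linearized dynamics $$\delta z^+(t)=\left.\frac{\partial g}{\partial z}\right|_{z=0}\delta z(t),\quad t\in I,\qquad \delta z(t_0)=z_0,$$ admit constants $C_{\mathrm l}\ge 1$ and $\alpha>0$ such that $$|\delta z(t)|\le C_{\mathrm l}\,|\delta z(t_0)|\,e^{-\alpha(t-t_0)}\qquad\text{for all } z_0\in\mathbb{R}^{2n},\ t_0,t\in I,\ t\ge t_0 .$$ Let $\mathcal{R}:=\{z_0\in\mathbb{R}^{2n} : \lim_{t\to\infty}\varphi_t(z_0)=0\}$. Then for any compact set $A\subset\mathcal{R}$ there exists a finite constant $\hat C\ge 1$ such that for all $z_0\in A$ $$|\varphi_t(z_0)|\le \hat C\,|z_0|\,e^{-\alpha t}\qquad\text{for all } t\in I .$$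
   Context: The statement covers two settings simultaneously. In continuous time, $I=\mathbb{R}_{\ge0}$ and $z^+(t)$ denotes the derivative $\dot z(t)$. In discrete time, $I=\{0,1,2,\dots\}$ and $z^+(t)=z(t+1)$. We write $z=(q,p)\in\mathbb{R}^n\times\mathbb{R}^n$, and $|\cdot|$ is the Euclidean norm. The flow $\varphi_t:\mathbb{R}^{2n}\to\mathbb{R}^{2n}$ maps $z_0$ to the value at time $t$ of the solution of $z^+=g(z)$, $z(0)=z_0$; solutions exist and are unique for all $t\in I$. That the origin is an asymptotically stable equilibrium means: $\varphi_t(0)=0$ for all $t\in I$, $\varphi_t$ is continuous at $0$ uniformly in $t$, and $\lim_{t\to\infty}\varphi_t(z_0)=0$ for any $z_0$ in a neighborhood of the origin. *)

theory Defs
  imports "HOL-Analysis.Analysis"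
begin

text \<open>
  Both time scales are embedded into the reals, so that one formulation covers differential and
  difference equations. A trajectory is a function on the reals of which only the values on the
  time set matter; all notions below are therefore relativised to it.
\<close>

datatype time_scale = Continuous | Discrete

definition time_set :: "time_scale \<Rightarrow> real set" where
  "time_set T = (case T of Continuous \<Rightarrow> {0..} | Discrete \<Rightarrow> \<nat>)"

definition time_at_top :: "time_scale \<Rightarrow> real filter" where
  "time_at_top T = inf at_top (principal (time_set T))"

text \<open>
  Forward solutions of \<open>z\<^sup>+ = f z\<close> on the part of the time set from \<open>t0\<close> on. No backward
  solution is demanded, since in discrete time it need not exist.
  At \<open>t = t0\<close> the derivative is one-sided.
\<close>

definition solves_from ::
    "time_scale \<Rightarrow> ('a::real_normed_vector \<Rightarrow> 'a) \<Rightarrow> real \<Rightarrow> (real \<Rightarrow> 'a) \<Rightarrow> bool" where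
  "solves_from T f t0 z =
    (case T of
       Continuous \<Rightarrow> \<forall>t\<ge>t0. (z has_vector_derivative f (z t)) (at t within {t0..})
     | Discrete \<Rightarrow> \<forall>t\<in>\<nat>. t \<ge> t0 \<longrightarrow> z (t + 1) = f (z t))"

text \<open>Global existence and uniqueness of solutions are part of being the flow of \<open>f\<close>.\<close>

definition is_flow ::
    "time_scale \<Rightarrow> ('a::real_normed_vector \<Rightarrow> 'a) \<Rightarrow> (real \<Rightarrow> 'a \<Rightarrow> 'a) \<Rightarrow> bool" where
  "is_flow T f \<phi> \<longleftrightarrow>
    (\<forall>z0. solves_from T f 0 (\<lambda>t. \<phi> t z0) \<and> \<phi> 0 z0 = z0 \<and>
          (\<forall>z. solves_from T f 0 z \<and> z 0 = z0 \<longrightarrow> (\<forall>t\<in>time_set T. z t = \<phi> t z0)))"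

definition region_of_attraction ::
    "time_scale \<Rightarrow> (real \<Rightarrow> 'a \<Rightarrow> 'a::real_normed_vector) \<Rightarrow> 'a set" where
  "region_of_attraction T \<phi> = {z0. ((\<lambda>t. \<phi> t z0) \<longlongrightarrow> 0) (time_at_top T)}"

definition asymptotically_stable_origin ::
    "time_scale \<Rightarrow> (real \<Rightarrow> 'a \<Rightarrow> 'a::real_normed_vector) \<Rightarrow> bool" where
  "asymptotically_stable_origin T \<phi> \<longleftrightarrow>
    (\<forall>t\<in>time_set T. \<phi> t 0 = 0) \<and>
    (\<forall>e>0. \<exists>d>0. \<forall>z. dist z 0 < d \<longrightarrow> (\<forall>t\<in>time_set T. dist (\<phi> t z) (\<phi> t 0) < e)) \<and>
    (\<exists>U. open U \<and> 0 \<in> U \<and> (\<forall>z0\<in>U. ((\<lambda>t. \<phi> t z0) \<longlongrightarrow> 0) (time_at_top T)))"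

end

theory Submission imports Defs begin

text \<open>
  Since \<open>g z - Dg 0 z\<close> is quadratic in \<open>z\<close>, the variation of constants formula shows that a trajectory
  bounded by \<open>M e\<^sup>-\<^sup>\<alpha>\<^sup>s\<close> before time \<open>t\<close> satisfies \<open>|\<phi>\<^sub>t z| \<le> (C |z| + K M\<^sup>2) e\<^sup>-\<^sup>\<alpha>\<^sup>t\<close>. Squaring makes the
  perturbation integrable against the weight \<open>e\<^sup>\<alpha>\<^sup>s\<close>, so no part of the rate \<open>\<alpha>\<close> is lost. With \<open>M = 2 C |z|\<close>
  and \<open>z\<close> small the bound reproduces itself strictly, which gives decay with rate \<open>\<alpha>\<close> near the origin. A
  point of the region of attraction enters this neighbourhood in finite time, and by continuous
  dependence all nearby points do so at the same time; compactness makes the constant uniform.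
\<close>

section \<open>The linear semigroup\<close>

text \<open>The terms are dominated by those of the scalar exponential series at
  \<open>r * K\<close>, uniformly for \<bar>t\<bar> \<le> r, so termwise differentiation is allowed.
  It lowers the factorial by one and hence shifts the coefficients.\<close>

lemma exponential_series:
  fixes c :: "nat \<Rightarrow> 'b::banach"
  assumes bound: "\<And>k. norm (c k) \<le> B * K ^ k" and "K \<ge> 0"
  shows summable_exponential_series: "summable (\<lambda>k. (t ^ k / fact k) *\<^sub>R c k)"
    and exponential_series_has_vector_derivative:
      "((\<lambda>t. \<Sum>k. (t ^ k / fact k) *\<^sub>R c k) has_vector_derivative
        (\<Sum>k. (t ^ k / fact k) *\<^sub>R c (Suc k))) (at t)"
proof -
  \<comment> \<open>The coefficients are left general because the estimate serves both for
    \<open>c\<close> and, with \<open>B * K\<close> for \<open>B'\<close>, for the shifted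
    coefficients of the derivative series.\<close>
  have majorant: "norm ((t ^ k / fact k) *\<^sub>R b k) \<le> B' * ((r * K) ^ k / fact k)"
    if "\<bar>t\<bar> \<le> r" "\<And>k. norm (b k) \<le> B' * K ^ k" for t r k B' and b :: "nat \<Rightarrow> 'b"
  proof -
    have "norm ((t ^ k / fact k) *\<^sub>R b k) = (\<bar>t\<bar> ^ k / fact k) * norm (b k)"
      by (simp add: power_abs)
    also have "\<dots> \<le> (r ^ k / fact k) * (B' * K ^ k)"
      using that by (intro mult_mono divide_right_mono power_mono) auto
    finally show ?thesis
      by (simp add: power_mult_distrib field_simps)
  qed
  have summable_majorant: "summable (\<lambda>k. B' * ((r * K) ^ k / fact k))" for r B' :: real
    using summable_exp_generic[of "r * K"] by (intro summable_mult) (simp add: field_simps)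
  have summable: "summable (\<lambda>k. (t ^ k / fact k) *\<^sub>R c k)" for t
    by (rule summable_comparison_test'[OF summable_majorant, of 0])
      (use majorant[OF order_refl bound] in auto)
  show "summable (\<lambda>k. (t ^ k / fact k) *\<^sub>R c k)" by (rule summable)

  define r where "r = \<bar>t\<bar> + 1"
  define G where "G = (\<lambda>x. \<Sum>k. (x ^ k / fact k) *\<^sub>R c (Suc k))"
  define f' where "f' = (\<lambda>n x h. h *\<^sub>R (case n of 0 \<Rightarrow> 0 | Suc k \<Rightarrow> (x ^ k / fact k) *\<^sub>R c (Suc k)))"
  have bound_Suc: "norm (c (Suc k)) \<le> (B * K) * K ^ k" for k
    using bound[of "Suc k"] by (simp add: ac_simps)
  have unif: "uniform_limit (ball 0 r) (\<lambda>n x. \<Sum>i<n. (x ^ i / fact i) *\<^sub>R c (Suc i)) G sequentially"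
    unfolding G_def
    by (rule Weierstrass_m_test[OF majorant[OF _ bound_Suc, of _ r] summable_majorant]) auto
  have "\<exists>g. \<forall>x\<in>ball 0 r. (\<lambda>n. (x ^ n / fact n) *\<^sub>R c n) sums (g x) \<and>
          (g has_derivative (\<lambda>h. h *\<^sub>R G x)) (at x within ball 0 r)"
  proof (rule has_derivative_series[where f' = f'])
    show "((\<lambda>x. (x ^ n / fact n) *\<^sub>R c n) has_derivative f' n x) (at x within ball 0 r)" for n x
    proof (cases n)
      case 0
      then show ?thesis by (simp add: f'_def)
    next
      case (Suc k)
      have "((\<lambda>x. x ^ n / fact n) has_real_derivative x ^ k / fact k) (at x within ball 0 r)"
        by (rule derivative_eq_intros refl | simp)+ (simp add: Suc del: of_nat_Suc)
      then have "((\<lambda>x. x ^ n / fact n) has_derivative (\<lambda>h. h * (x ^ k / fact k))) (at x within ball 0 r)"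
        unfolding has_field_derivative_def by (metis (no_types) mult.commute ext)
      then show ?thesis
        using has_derivative_scaleR_left by (force simp: f'_def Suc)
    qed
    show "\<forall>\<^sub>F n in sequentially. \<forall>x\<in>ball 0 r. \<forall>h. norm ((\<Sum>i<n. f' i x h) - h *\<^sub>R G x) \<le> e * norm h"
      if "e > 0" for e
    proof -
      have "\<forall>\<^sub>F n in sequentially. \<forall>x\<in>ball 0 r. norm ((\<Sum>i<n. (x ^ i / fact i) *\<^sub>R c (Suc i)) - G x) < e"
        using unif that unfolding uniform_limit_iff dist_norm by blast
      \<comment> \<open>The term of index 0 is constant and has derivative zero, so
        \<open>Suc n\<close> differentiated terms make up the partial sum of length \<open>n\<close>
        of \<open>G\<close>. The index shift is undone after the estimate.\<close>
      then have "\<forall>\<^sub>F n in sequentially. \<forall>x\<in>ball 0 r. \<forall>h. norm ((\<Sum>i<Suc n. f' i x h) - h *\<^sub>R G x) \<le> e * norm h"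
      proof eventually_elim
        case (elim n)
        show ?case
        proof (intro ballI allI)
          fix x :: real and h :: real assume "x \<in> ball 0 r"
          have "(\<Sum>i<Suc n. f' i x h) - h *\<^sub>R G x
              = h *\<^sub>R ((\<Sum>i<n. (x ^ i / fact i) *\<^sub>R c (Suc i)) - G x)"
            by (simp add: sum.lessThan_Suc_shift f'_def scaleR_diff_right scaleR_right.sum del: sum.lessThan_Suc)
          then show "norm ((\<Sum>i<Suc n. f' i x h) - h *\<^sub>R G x) \<le> e * norm h"
            using elim \<open>x \<in> ball 0 r\<close>
            by (simp add: mult.commute[of e] mult_left_mono less_imp_le del: sum.lessThan_Suc)
        qed
      qed
      then show ?thesis
        by (subst (asm) eventually_sequentially_Suc)
    qed
    show "(\<lambda>n. (0 ^ n / fact n) *\<^sub>R c n) sums (\<Sum>n. (0 ^ n / fact n) *\<^sub>R c n)"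
      using summable by (rule summable_sums)
  qed (auto simp: r_def)
  then obtain g where g: "\<And>x. x \<in> ball 0 r \<Longrightarrow> (\<lambda>n. (x ^ n / fact n) *\<^sub>R c n) sums (g x)"
    "\<And>x. x \<in> ball 0 r \<Longrightarrow> (g has_derivative (\<lambda>h. h *\<^sub>R G x)) (at x within ball 0 r)" by blast
  have t: "t \<in> ball 0 r" by (simp add: r_def)
  have "(g has_vector_derivative G t) (at t)"
    using g(2)[OF t] t by (simp add: has_vector_derivative_def at_within_open[OF t])
  then show "((\<lambda>t. \<Sum>k. (t ^ k / fact k) *\<^sub>R c k) has_vector_derivative
        (\<Sum>k. (t ^ k / fact k) *\<^sub>R c (Suc k))) (at t)"
    using has_vector_derivative_transform_within_open[of g "G t" t "ball 0 r"
        "\<lambda>t. \<Sum>k. (t ^ k / fact k) *\<^sub>R c k"] t g(1) sums_unique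
    by (fastforce simp: G_def)
qed

text \<open>\<open>E t\<close> is the operator exponential of \<open>t A\<close>. The form with
  \<open>A\<close> on the left makes \<open>E t v\<close> a solution of the linear equation, which
  gives access to its decay; the form with \<open>A\<close> on the right is the one for
  differentiating \<open>E (t - s) (z s)\<close> in \<open>s\<close>.\<close>

lemma linear_semigroup_exists:
  fixes A :: "'a::banach \<Rightarrow>\<^sub>L 'a"
  obtains E where "E 0 = id_blinfun"
    "\<And>t. (E has_vector_derivative A o\<^sub>L E t) (at t)"
    "\<And>t. (E has_vector_derivative E t o\<^sub>L A) (at t)"
proof -
  define P where "P k = (((o\<^sub>L) A) ^^ k) id_blinfun" for k
  define E where "E t = (\<Sum>k. (t ^ k / fact k) *\<^sub>R P k)" for t
  have P_Suc: "P (Suc k) = A o\<^sub>L P k" for k by (simp add: P_def)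
  \<comment> \<open>\<open>P k\<close> is the k-th power of \<open>A\<close>, and \<open>A\<close>
    commutes with its own powers; this yields the second form of the derivative.\<close>
  have P_Suc': "P (Suc k) = P k o\<^sub>L A" for k
  proof (induction k)
    case 0
    show ?case by (auto simp: P_def intro: blinfun_eqI)
  next
    case (Suc k)
    have "P (Suc (Suc k)) = A o\<^sub>L (P k o\<^sub>L A)" using Suc P_Suc[of "Suc k"] by simp
    also have "\<dots> = P (Suc k) o\<^sub>L A" by (rule blinfun_eqI) (simp add: P_Suc)
    finally show ?case .
  qed
  have bound: "norm (P k) \<le> 1 * norm A ^ k" for k
  proof (induction k)
    case 0
    show ?case by (simp add: P_def norm_blinfun_id_le)
  next
    case (Suc k)
    have "norm (P (Suc k)) \<le> norm A * norm (P k)" unfolding P_Suc by (rule norm_blinfun_compose)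
    also have "\<dots> \<le> norm A * (1 * norm A ^ k)" by (rule mult_left_mono[OF Suc]) simp
    finally show ?case by simp
  qed
  note summable = summable_exponential_series[OF bound norm_ge_zero]
  have deriv: "(E has_vector_derivative (\<Sum>k. (t ^ k / fact k) *\<^sub>R P (Suc k))) (at t)" for t
    unfolding E_def[abs_def] by (rule exponential_series_has_vector_derivative[OF bound norm_ge_zero])
  interpret comp: bounded_bilinear "(o\<^sub>L) :: ('a \<Rightarrow>\<^sub>L 'a) \<Rightarrow> ('a \<Rightarrow>\<^sub>L 'a) \<Rightarrow> ('a \<Rightarrow>\<^sub>L 'a)"
    by (rule bounded_bilinear_blinfun_compose)
  have left: "(\<Sum>k. (t ^ k / fact k) *\<^sub>R P (Suc k)) = A o\<^sub>L E t" for t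
    using bounded_linear.suminf[OF comp.bounded_linear_right[of A] summable[of t]]
    by (simp add: E_def P_Suc comp.scaleR_right)
  have right: "(\<Sum>k. (t ^ k / fact k) *\<^sub>R P (Suc k)) = E t o\<^sub>L A" for t
    using bounded_linear.suminf[OF comp.bounded_linear_left[of A] summable[of t]]
    by (simp add: E_def P_Suc' comp.scaleR_left)
  have "E 0 = P 0"
    unfolding E_def by (subst suminf_finite[of "{0}"]) auto
  then have "E 0 = id_blinfun" by (simp add: P_def)
  then show ?thesis using that[of E] deriv left right by simp
qed

section \<open>Estimates for the nonlinear perturbation\<close>

text \<open>Mean value inequality for \<open>g - Dg 0\<close> on the ball of radius
  \<open>norm x\<close>, where the Lipschitz condition bounds its derivative by
  \<open>L * norm x\<close>.\<close>

lemma quadratic_remainder: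
  fixes g :: "'a::real_normed_vector \<Rightarrow> 'b::real_normed_vector"
  assumes deriv: "\<And>z. (g has_derivative blinfun_apply (Dg z)) (at z)"
    and lip: "L-lipschitz_on UNIV Dg" and "g 0 = 0"
  shows "norm (g x - Dg 0 x) \<le> L * (norm x)\<^sup>2"
proof -
  have "norm ((g x - Dg 0 x) - (g 0 - Dg 0 0)) \<le> (L * norm x) * norm (x - 0)"
  proof (rule differentiable_bound[where S = "cball 0 (norm x)" and f' = "\<lambda>z. blinfun_apply (Dg z - Dg 0)"])
    show "((\<lambda>a. g a - Dg 0 a) has_derivative blinfun_apply (Dg y - Dg 0)) (at y within cball 0 (norm x))" for y
      by (rule derivative_eq_intros has_derivative_at_withinI[OF deriv] refl | simp add: blinfun.diff_left fun_eq_iff)+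
    fix y :: 'a assume y: "y \<in> cball 0 (norm x)"
    have "onorm (blinfun_apply (Dg y - Dg 0)) = norm (Dg y - Dg 0)" by (simp add: norm_blinfun.rep_eq)
    also have "\<dots> \<le> L * norm y"
      using lipschitz_onD[OF lip, of y 0] by (simp add: dist_norm)
    also have "\<dots> \<le> L * norm x"
      using y lipschitz_on_nonneg[OF lip] by (intro mult_left_mono) auto
    finally show "onorm (blinfun_apply (Dg y - Dg 0)) \<le> L * norm x" .
  qed auto
  then show ?thesis using \<open>g 0 = 0\<close> by (simp add: power2_eq_square ac_simps)
qed

text \<open>The derivative may grow linearly in the distance from the origin, so the Lipschitz
  constant of \<open>g\<close> has to depend on the radius.\<close>

lemma lipschitz_on_cball_if_lipschitz_derivative:
  fixes g :: "'a::real_normed_vector \<Rightarrow> 'b::real_normed_vector"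
  assumes deriv: "\<And>z. (g has_derivative blinfun_apply (Dg z)) (at z)"
    and lip: "L-lipschitz_on UNIV Dg" and "R \<ge> 0"
  shows "(norm (Dg 0) + L * R)-lipschitz_on (cball 0 R) g"
proof (rule lipschitz_onI)
  show "0 \<le> norm (Dg 0) + L * R" using lipschitz_on_nonneg[OF lip] \<open>R \<ge> 0\<close> by simp
  fix x y :: 'a assume xy: "x \<in> cball 0 R" "y \<in> cball 0 R"
  have "norm (g x - g y) \<le> (norm (Dg 0) + L * R) * norm (x - y)"
  proof (rule differentiable_bound[where S = "cball 0 R" and f' = "\<lambda>z. blinfun_apply (Dg z)"])
    show "(g has_derivative blinfun_apply (Dg z)) (at z within cball 0 R)" for z
      by (rule has_derivative_at_withinI[OF deriv])
    fix z :: 'a assume z: "z \<in> cball 0 R"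
    have "norm (Dg z) \<le> norm (Dg 0) + norm (Dg z - Dg 0)" by (metis add.commute diff_add_cancel norm_triangle_ineq)
    also have "norm (Dg z - Dg 0) \<le> L * norm z"
      using lipschitz_onD[OF lip, of z 0] by (simp add: dist_norm)
    also have "\<dots> \<le> L * R"
      using z lipschitz_on_nonneg[OF lip] by (intro mult_left_mono) auto
    finally show "onorm (blinfun_apply (Dg z)) \<le> norm (Dg 0) + L * R" by (simp add: norm_blinfun.rep_eq)
  qed (use xy in auto)
  then show "dist (g x) (g y) \<le> (norm (Dg 0) + L * R) * dist x y" by (simp add: dist_norm)
qed

section \<open>Variation of constants and growth of differences\<close>

text \<open>The curve \<open>E (t - s) (z s)\<close> joins \<open>E t (z 0)\<close> to
  \<open>z t\<close>, and only the remainder survives in its derivative. Comparing it with an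
  explicit scalar antiderivative replaces integration.\<close>

lemma variation_of_constants_bound_continuous:
  fixes A :: "'a::banach \<Rightarrow>\<^sub>L 'a" and z :: "real \<Rightarrow> 'a"
  assumes E: "E 0 = id_blinfun" "\<And>t. (E has_vector_derivative E t o\<^sub>L A) (at t)"
    and E_bound: "\<And>t v. t \<ge> 0 \<Longrightarrow> norm (E t v) \<le> C * norm v * exp (- \<alpha> * t)"
    and "C \<ge> 1" "\<alpha> > 0" "L \<ge> 0" "t \<ge> 0"
    and rem: "\<And>x. norm (g x - A x) \<le> L * (norm x)\<^sup>2"
    and z: "\<And>s. s \<ge> 0 \<Longrightarrow> (z has_vector_derivative g (z s)) (at s within {0..})"
    and M: "\<And>s. 0 \<le> s \<Longrightarrow> s < t \<Longrightarrow> norm (z s) \<le> M * exp (- \<alpha> * s)"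
  shows "norm (z t) \<le> (C * norm (z 0) + C * L / \<alpha> * M\<^sup>2) * exp (- \<alpha> * t)"
proof (cases "t = 0")
  case True
  have "norm (z 0) \<le> C * norm (z 0)" using \<open>C \<ge> 1\<close> by (simp add: mult_le_cancel_right1)
  then show ?thesis using True assms by (simp add: add_increasing2)
next
  case False
  with \<open>t \<ge> 0\<close> have t: "0 < t" by simp
  define h where "h s = E (t - s) (z s)" for s
  \<comment> \<open>An antiderivative of the bound on the derivative of \<open>h\<close>: the
    squared decay up to \<open>s\<close> and the decay of \<open>E (t - s)\<close> multiply to
    \<open>exp (- \<alpha> * t) * exp (- \<alpha> * s)\<close>. Its value at 0 supplies the constant
    \<open>C * L / \<alpha>\<close>.\<close>
  define \<psi> where "\<psi> s = - (C * L * M\<^sup>2 / \<alpha>) * exp (- \<alpha> * t) * exp (- \<alpha> * s)" for s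
  have E': "((\<lambda>s. E (t - s)) has_vector_derivative - (E (t - s) o\<^sub>L A)) (at s within S)" for s S
  proof -
    have "((\<lambda>s. t - s) has_vector_derivative -1) (at s within S)"
      by (rule derivative_eq_intros refl | simp)+
    from vector_diff_chain_within[OF this has_vector_derivative_at_within[OF E(2)]]
    show ?thesis by (simp add: o_def)
  qed
  have h': "(h has_vector_derivative E (t - s) (g (z s) - A (z s))) (at s within S)"
    if "(z has_vector_derivative g (z s)) (at s within S)" for s S
    using bounded_bilinear.has_vector_derivative[OF bounded_bilinear_blinfun_apply E' that]
    unfolding h_def[abs_def] by (simp add: blinfun.diff_right blinfun.minus_left)
  have "norm (h t - h 0) \<le> \<psi> t - \<psi> 0"
  proof (rule differentiable_bound_general[OF t])
    show "continuous_on {0..t} h"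
      by (rule continuous_on_subset[of "{0..}"], rule continuous_on_vector_derivative, rule h', rule z) auto
    show "continuous_on {0..t} \<psi>" unfolding \<psi>_def by (intro continuous_intros)
    fix s assume s: "0 < s" "s < t"
    have "(z has_vector_derivative g (z s)) (at s)"
      using has_vector_derivative_within_subset[OF z[of s], of "{0<..}"] s Ioi_le_Ico[of 0]
      by (simp add: at_within_open[of s "{0<..}"])
    then show "(h has_vector_derivative E (t - s) (g (z s) - A (z s))) (at s)" by (rule h')
    show "(\<psi> has_vector_derivative C * L * M\<^sup>2 * exp (- \<alpha> * t) * exp (- \<alpha> * s)) (at s)"
      unfolding \<psi>_def has_real_derivative_iff_has_vector_derivative[symmetric]
      by (rule derivative_eq_intros refl | simp)+ (use \<open>\<alpha> > 0\<close> in \<open>simp add: field_simps\<close>)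
    have "norm (g (z s) - A (z s)) \<le> L * (M * exp (- \<alpha> * s))\<^sup>2"
      using rem[of "z s"] M[of s] s \<open>L \<ge> 0\<close>
      by (meson dual_order.trans less_imp_le mult_left_mono norm_ge_zero power_mono)
    then have "norm (E (t - s) (g (z s) - A (z s))) \<le> C * (L * (M * exp (- \<alpha> * s))\<^sup>2) * exp (- \<alpha> * (t - s))"
      using E_bound[of "t - s" "g (z s) - A (z s)"] s \<open>C \<ge> 1\<close>
      by (smt (verit) exp_ge_zero mult_left_mono mult_right_mono)
    also have "\<dots> = C * L * M\<^sup>2 * (exp (- \<alpha> * s) * exp (- \<alpha> * s) * exp (- \<alpha> * (t - s)))"
      by (simp add: power2_eq_square)
    also have "exp (- \<alpha> * s) * exp (- \<alpha> * s) * exp (- \<alpha> * (t - s)) = exp (- \<alpha> * t) * exp (- \<alpha> * s)"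
      by (simp add: exp_add[symmetric] algebra_simps)
    finally show "norm (E (t - s) (g (z s) - A (z s))) \<le> C * L * M\<^sup>2 * exp (- \<alpha> * t) * exp (- \<alpha> * s)"
      by simp
  qed
  moreover have "norm (h 0) \<le> C * norm (z 0) * exp (- \<alpha> * t)"
    using E_bound[of t "z 0"] t by (simp add: h_def)
  moreover have "h t = z t" by (simp add: h_def E)
  moreover have "\<psi> t \<le> 0" using assms by (simp add: \<psi>_def)
  moreover have "- \<psi> 0 = C * L / \<alpha> * M\<^sup>2 * exp (- \<alpha> * t)" by (simp add: \<psi>_def)
  ultimately show ?thesis
    using norm_triangle_sub[of "h t" "h 0"] by (simp add: distrib_right)
qed

text \<open>The same estimate with a telescoping sum in place of the integral. The geometric series
  gives \<open>1 / (1 - exp (- \<alpha>))\<close>; the factor \<open>exp \<alpha>\<close> pays for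
  the step in which a remainder arises, as no power of the matrix acts during it.\<close>

lemma variation_of_constants_bound_discrete:
  fixes A :: "'a::real_normed_vector \<Rightarrow>\<^sub>L 'a" and y :: "nat \<Rightarrow> 'a"
  assumes A_bound: "\<And>n v. norm ((blinfun_apply A ^^ n) v) \<le> C * norm v * exp (- \<alpha> * real n)"
    and "C \<ge> 1" "\<alpha> > 0" "L \<ge> 0"
    and rem: "\<And>x. norm (g x - A x) \<le> L * (norm x)\<^sup>2"
    and y: "\<And>n. y (Suc n) = g (y n)"
    and M: "\<And>k. k < n \<Longrightarrow> norm (y k) \<le> M * exp (- \<alpha> * real k)"
  shows "norm (y n) \<le> (C * norm (y 0) + C * L * exp \<alpha> / (1 - exp (- \<alpha>)) * M\<^sup>2) * exp (- \<alpha> * real n)"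
proof -
  define D where "D = C * L * M\<^sup>2 * exp \<alpha>"
  have D: "D \<ge> 0" using assms by (simp add: D_def)
  have lin: "linear (blinfun_apply A ^^ m)" for m
  proof (induction m)
    case 0
    show ?case by (simp add: id_def linear_ident)
  next
    case (Suc m)
    show ?case
      using linear_compose[OF Suc bounded_linear.linear[OF blinfun.bounded_linear_right[of A]]] by (simp add: o_def)
  qed
  \<comment> \<open>The free exponent \<open>m\<close> is needed for the induction: peeling off the
    last step of \<open>y (Suc k)\<close> leaves the claim for \<open>k\<close> with exponent
    \<open>Suc m\<close>. The case used is \<open>m = 0\<close>, \<open>k = n\<close>.\<close>
  have telescope: "norm ((blinfun_apply A ^^ m) (y k) - (blinfun_apply A ^^ (m + k)) (y 0))
      \<le> D * exp (- \<alpha> * real (m + k)) * (\<Sum>i<k. exp (- \<alpha>) ^ i)" if "k \<le> n" for k m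
    using that
  proof (induction k arbitrary: m)
    case 0
    then show ?case by simp
  next
    case (Suc k)
    let ?r = "g (y k) - A (y k)"
    have split: "(blinfun_apply A ^^ m) (y (Suc k)) - (blinfun_apply A ^^ (m + Suc k)) (y 0)
      = ((blinfun_apply A ^^ Suc m) (y k) - (blinfun_apply A ^^ (Suc m + k)) (y 0)) + (blinfun_apply A ^^ m) ?r"
      by (simp add: y funpow_swap1 linear_diff[OF lin])
    have "norm ?r \<le> L * (M * exp (- \<alpha> * real k))\<^sup>2"
      using rem[of "y k"] M[of k] Suc.prems \<open>L \<ge> 0\<close>
      by (meson Suc_le_lessD dual_order.trans mult_left_mono norm_ge_zero power_mono)
    then have "norm ((blinfun_apply A ^^ m) ?r) \<le> C * (L * (M * exp (- \<alpha> * real k))\<^sup>2) * exp (- \<alpha> * real m)"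
      using A_bound[of m ?r] \<open>C \<ge> 1\<close>
      by (smt (verit) exp_ge_zero mult_left_mono mult_right_mono)
    also have "\<dots> = C * L * M\<^sup>2 * (exp (- \<alpha> * real k) * exp (- \<alpha> * real k) * exp (- \<alpha> * real m))"
      by (simp add: power2_eq_square)
    also have "exp (- \<alpha> * real k) * exp (- \<alpha> * real k) * exp (- \<alpha> * real m)
        = exp \<alpha> * exp (- \<alpha> * real (m + Suc k)) * exp (- \<alpha>) ^ k"
      by (simp add: exp_add[symmetric] exp_of_nat_mult[symmetric] algebra_simps)
    finally have "norm ((blinfun_apply A ^^ m) ?r) \<le> D * exp (- \<alpha> * real (m + Suc k)) * exp (- \<alpha>) ^ k"
      by (simp add: D_def)
    moreover have "norm ((blinfun_apply A ^^ Suc m) (y k) - (blinfun_apply A ^^ (Suc m + k)) (y 0))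
        \<le> D * exp (- \<alpha> * real (m + Suc k)) * (\<Sum>i<k. exp (- \<alpha>) ^ i)"
      using Suc.IH[of "Suc m"] Suc.prems by (simp add: algebra_simps)
    ultimately show ?case
      unfolding split by (simp add: distrib_left norm_triangle_mono)
  qed
  have "(\<Sum>i<n. exp (- \<alpha>) ^ i) \<le> (\<Sum>i. exp (- \<alpha>) ^ i)"
    using \<open>\<alpha> > 0\<close> by (intro sum_le_suminf summable_geometric) auto
  also have "\<dots> = 1 / (1 - exp (- \<alpha>))"
    using \<open>\<alpha> > 0\<close> by (intro suminf_geometric) auto
  finally have "D * exp (- \<alpha> * real n) * (\<Sum>i<n. exp (- \<alpha>) ^ i) \<le> D * exp (- \<alpha> * real n) * (1 / (1 - exp (- \<alpha>)))"
    using D by (intro mult_left_mono) auto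
  with telescope[of n 0] have "norm (y n - (blinfun_apply A ^^ n) (y 0)) \<le> D * exp (- \<alpha> * real n) / (1 - exp (- \<alpha>))"
    by simp
  with A_bound[of n "y 0"] norm_triangle_sub[of "y n" "(blinfun_apply A ^^ n) (y 0)"]
  have "norm (y n) \<le> C * norm (y 0) * exp (- \<alpha> * real n) + D * exp (- \<alpha> * real n) / (1 - exp (- \<alpha>))"
    by linarith
  then show ?thesis by (simp add: D_def algebra_simps)
qed

text \<open>A Gronwall estimate: by Cauchy-Schwarz the weighted square \<open>q\<close> of the
  distance is nonincreasing. The square is differentiable even where the trajectories meet.
  Membership in \<open>S\<close> is asked only strictly before \<open>t\<close>, which is what a
  bootstrap argument provides; continuity covers the endpoints.\<close>

lemma lipschitz_growth:
  fixes x y :: "real \<Rightarrow> 'a::real_inner"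
  assumes lip: "B-lipschitz_on S g" and "t \<ge> 0"
    and x: "\<And>s. s \<ge> 0 \<Longrightarrow> (x has_vector_derivative g (x s)) (at s within {0..})"
    and y: "\<And>s. s \<ge> 0 \<Longrightarrow> (y has_vector_derivative g (y s)) (at s within {0..})"
    and S: "\<And>s. 0 < s \<Longrightarrow> s < t \<Longrightarrow> x s \<in> S \<and> y s \<in> S"
  shows "dist (x t) (y t) \<le> dist (x 0) (y 0) * exp (B * t)"
proof -
  define d where "d s = x s - y s" for s
  define q where "q s = exp (- 2 * B * s) * (d s \<bullet> d s)" for s
  have d: "(d has_vector_derivative g (x s) - g (y s)) (at s within {0..})" if "s \<ge> 0" for s
    unfolding d_def[abs_def] using x y that by (intro derivative_intros) auto
  have q: "(q has_vector_derivative exp (- 2 * B * s) * (2 * (d s \<bullet> (g (x s) - g (y s))) - 2 * B * (d s \<bullet> d s)))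
      (at s within {0..})" if "s \<ge> 0" for s
  proof -
    have "((\<lambda>s. exp (- 2 * B * s)) has_vector_derivative exp (- 2 * B * s) * (- 2 * B)) (at s within {0..})"
      unfolding has_real_derivative_iff_has_vector_derivative[symmetric]
      by (rule derivative_eq_intros refl | simp)+
    from has_vector_derivative_mult[OF this bounded_bilinear.has_vector_derivative[OF bounded_bilinear_inner d[OF that] d[OF that]]]
    show ?thesis
      unfolding q_def[abs_def]
      by (rule has_vector_derivative_eq_rhs) (simp add: algebra_simps inner_commute)
  qed
  have "q 0 \<ge> q t"
  proof (rule DERIV_nonpos_imp_decreasing_open[OF \<open>t \<ge> 0\<close>])
    show "continuous_on {0..t} q"
      by (rule continuous_on_subset[of "{0..}"], rule continuous_on_vector_derivative, rule q) auto
    fix s assume s: "0 < s" "s < t"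
    have "norm (g (x s) - g (y s)) \<le> B * norm (d s)"
      using lipschitz_onD[OF lip] S[OF s] by (simp add: dist_norm d_def)
    then have "d s \<bullet> (g (x s) - g (y s)) \<le> norm (d s) * (B * norm (d s))"
      by (meson mult_left_mono norm_cauchy_schwarz norm_ge_zero order_trans)
    also have "\<dots> = B * (d s \<bullet> d s)"
      by (simp add: dot_square_norm power2_eq_square)
    finally have "exp (- 2 * B * s) * (2 * (d s \<bullet> (g (x s) - g (y s))) - 2 * B * (d s \<bullet> d s)) \<le> 0"
      by (simp add: mult_le_0_iff)
    moreover have "(q has_real_derivative exp (- 2 * B * s) * (2 * (d s \<bullet> (g (x s) - g (y s))) - 2 * B * (d s \<bullet> d s))) (at s)"
      unfolding has_real_derivative_iff_has_vector_derivative
      using has_vector_derivative_within_subset[OF q[of s], of "{0<..}"] s Ioi_le_Ico[of 0]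
      by (simp add: at_within_open[of s "{0<..}"])
    ultimately show "\<exists>y. DERIV q s :> y \<and> y \<le> 0" by blast
  qed
  then have "exp (- 2 * B * t) * (norm (d t))\<^sup>2 \<le> (norm (d 0))\<^sup>2"
    by (simp add: q_def dot_square_norm)
  then have "exp (2 * B * t) * (exp (- 2 * B * t) * (norm (d t))\<^sup>2) \<le> exp (2 * B * t) * (norm (d 0))\<^sup>2"
    by (rule mult_left_mono) simp
  then have "(norm (d t))\<^sup>2 \<le> (norm (d 0) * exp (B * t))\<^sup>2"
    by (simp add: mult.assoc[symmetric] exp_add[symmetric] power_mult_distrib exp_double[symmetric])
      (simp add: mult.commute mult.left_commute)
  then have "norm (d t) \<le> norm (d 0) * exp (B * t)"
    by (rule power2_le_imp_le) simp
  then show ?thesis by (simp add: d_def dist_norm)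
qed

section \<open>Time sets and flows\<close>

lemma zero_in_time_set: "0 \<in> time_set T"
  by (cases T) (auto simp: time_set_def)

lemma time_set_nonneg: "t \<in> time_set T \<Longrightarrow> t \<ge> 0"
  by (cases T) (auto simp: time_set_def elim: Nats_cases)

lemma of_nat_in_time_set: "real n \<in> time_set T"
  by (cases T) (auto simp: time_set_def)

lemma closed_time_set: "closed (time_set T)"
  by (cases T) (auto simp: time_set_def)

lemma time_set_diff: "s \<in> time_set T \<Longrightarrow> t \<in> time_set T \<Longrightarrow> s \<le> t \<Longrightarrow> t - s \<in> time_set T"
  by (cases T) (auto simp: time_set_def elim!: Nats_cases simp flip: of_nat_diff)

text \<open>Distinct naturals are at distance at least 1. This lets arguments by continuity in time
  cover the discrete scale as well.\<close>

lemma continuous_on_Nats: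
  fixes f :: "real \<Rightarrow> 'a::metric_space"
  shows "continuous_on \<nat> f"
proof -
  have "x = y" if "x \<in> \<nat>" "y \<in> \<nat>" "dist x y < 1" for x y :: real
    using that by (auto simp: dist_real_def elim!: Nats_cases)
  then have "\<exists>d>0. \<forall>y\<in>\<nat>. dist y x < d \<longrightarrow> dist (f y) (f x) < e"
    if "e > 0" "x \<in> \<nat>" for x :: real and e
    using that by (intro exI[of _ 1]) fastforce
  then show ?thesis
    unfolding continuous_on_iff by blast
qed

text \<open>
  Continuous induction for both time scales: at the first time of the closed set where \<open>M \<le> u\<close>, the
  step would give \<open>u < M\<close>. For the initial time the premise of the step is vacuous.
\<close>

lemma time_bootstrap:
  fixes u :: "real \<Rightarrow> real"
  assumes cont: "continuous_on (time_set T) u"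
    and step: "\<And>t. t \<in> time_set T \<Longrightarrow> t \<le> \<tau> \<Longrightarrow> (\<And>s. s \<in> time_set T \<Longrightarrow> s < t \<Longrightarrow> u s < M) \<Longrightarrow> u t < M"
    and t: "t \<in> time_set T" "t \<le> \<tau>"
  shows "u t < M"
proof (rule ccontr)
  assume contra: "\<not> u t < M"
  define B where "B = time_set T \<inter> u -` {M..}"
  have "closed B"
    unfolding B_def using cont closed_time_set by (rule continuous_closed_preimage) simp
  moreover have "t \<in> B" using contra t by (simp add: B_def)
  moreover have bdd: "bdd_below B"
    by (rule bdd_belowI[of _ 0]) (auto simp: B_def time_set_nonneg)
  ultimately have "Inf B \<in> B" by (intro closed_contains_Inf) auto
  moreover have below: "Inf B \<le> s" if "s \<in> B" for s using bdd that by (rule cInf_lower2[rotated 2]) simp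
  then have "u s < M" if "s \<in> time_set T" "s < Inf B" for s
    using that by (force simp: B_def)
  moreover have "Inf B \<le> \<tau>" using below[OF \<open>t \<in> B\<close>] t by simp
  ultimately show False using step[of "Inf B"] by (auto simp: B_def)
qed

text \<open>The equation is autonomous. In continuous time the shifted half-line lies inside the
  original one, so the one-sided derivative restricts to it.\<close>

lemma solves_from_shift:
  assumes z: "solves_from T f 0 z" and s: "s \<in> time_set T"
  shows "solves_from T f 0 (\<lambda>t. z (s + t))"
proof (cases T)
  case Continuous
  then have "s \<ge> 0" using s by (simp add: time_set_def)
  have "((\<lambda>t. z (s + t)) has_vector_derivative f (z (s + t))) (at t within {0..})" if "t \<ge> 0" for t
  proof -
    have "((+) s has_vector_derivative 1) (at t within {0..})"
      by (rule derivative_eq_intros refl | simp)+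
    moreover have "(z has_vector_derivative f (z (s + t))) (at (s + t) within (+) s ` {0..})"
      by (rule has_vector_derivative_within_subset[of _ _ _ "{0..}"])
        (use z \<open>s \<ge> 0\<close> that in \<open>auto simp: Continuous solves_from_def\<close>)
    ultimately show ?thesis
      using vector_diff_chain_within[of "(+) s" 1 t "{0..}" z] by (simp add: o_def)
  qed
  then show ?thesis by (simp add: Continuous solves_from_def)
next
  case Discrete
  have "z (s + (t + 1)) = f (z (s + t))" if "t \<in> \<nat>" for t
  proof -
    have "s + t \<in> \<nat>" using s that by (simp add: Discrete time_set_def)
    then have "z (s + t + 1) = f (z (s + t))"
      using z Nats_subset_Ints by (auto simp: Discrete solves_from_def Nats_def)
    then show ?thesis by (simp add: add.assoc)
  qed
  then show ?thesis by (simp add: Discrete solves_from_def)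
qed

section \<open>Elementary properties of the flow\<close>

context
  fixes T :: time_scale and g :: "'a::real_normed_vector \<Rightarrow> 'a" and \<phi> :: "real \<Rightarrow> 'a \<Rightarrow> 'a"
  assumes flow: "is_flow T g \<phi>"
begin

lemma flow_solves: "solves_from T g 0 (\<lambda>t. \<phi> t z)"
  and flow_zero: "\<phi> 0 z = z"
  using flow by (auto simp: is_flow_def)

text \<open>Both sides solve the equation in \<open>t\<close> with initial value
  \<open>\<phi> s z\<close>, so uniqueness applies.\<close>

lemma flow_semigroup:
  assumes "s \<in> time_set T" "t \<in> time_set T"
  shows "\<phi> (s + t) z = \<phi> t (\<phi> s z)"
proof -
  have "\<forall>x. solves_from T g 0 x \<and> x 0 = \<phi> s z \<longrightarrow> (\<forall>t\<in>time_set T. x t = \<phi> t (\<phi> s z))"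
    using flow unfolding is_flow_def by blast
  from spec[OF this, of "\<lambda>t. \<phi> (s + t) z"] show ?thesis
    using solves_from_shift[OF flow_solves assms(1)] assms(2) by simp
qed

lemma flow_discrete_Suc:
  assumes "T = Discrete"
  shows "\<phi> (real (Suc n)) z = g (\<phi> (real n) z)"
  using bspec[of \<nat> "\<lambda>t. t \<ge> 0 \<longrightarrow> \<phi> (t + 1) z = g (\<phi> t z)" "real n"] flow_solves[of z] assms
  by (simp add: solves_from_def add.commute)

lemma flow_continuous_on: "continuous_on (time_set T) (\<lambda>t. \<phi> t z)"
proof (cases T)
  case Continuous
  then show ?thesis
    using flow_solves[of z]
    by (auto simp: solves_from_def time_set_def intro!: continuous_on_vector_derivative)
next
  case Discrete
  then show ?thesis by (simp add: time_set_def continuous_on_Nats)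
qed

lemma flow_bounded:
  obtains R where "R \<ge> 0" "\<And>t. t \<in> time_set T \<Longrightarrow> t \<le> \<tau> \<Longrightarrow> norm (\<phi> t z) \<le> R"
proof -
  have "compact (time_set T \<inter> {0..\<tau>})"
    by (simp add: closed_Int_compact closed_time_set)
  then have "compact ((\<lambda>t. \<phi> t z) ` (time_set T \<inter> {0..\<tau>}))"
    using flow_continuous_on continuous_on_subset by (intro compact_continuous_image) blast+
  then obtain R where "\<forall>x \<in> (\<lambda>t. \<phi> t z) ` (time_set T \<inter> {0..\<tau>}). norm x \<le> R"
    using compact_imp_bounded bounded_iff by blast
  then have "norm (\<phi> t z) \<le> R" if "t \<in> time_set T" "t \<le> \<tau>" for t
    using that time_set_nonneg[OF that(1)] by simp
  \<comment> \<open>The maximum with 0 covers negative \<tau>, for which there are no times to bound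
    and \<open>R\<close> may be negative.\<close>
  then show ?thesis using that[of "max R 0"] by (simp add: le_max_iff_disj)
qed

text \<open>The trajectory of the origin is constant: its one-sided derivative at time 0, or its
  first step, gives \<open>g 0\<close>.\<close>

lemma flow_origin_imp_vanishing:
  assumes "\<And>t. t \<in> time_set T \<Longrightarrow> \<phi> t 0 = 0"
  shows "g 0 = 0"
proof (cases T)
  case Continuous
  then have "((\<lambda>t. \<phi> t 0) has_vector_derivative g 0) (at 0 within {0..})"
    using flow_solves[of 0] flow_zero by (auto simp: solves_from_def)
  moreover have "((\<lambda>t. \<phi> t 0) has_vector_derivative 0) (at 0 within {0..})"
    by (rule has_vector_derivative_transform[of _ _ _ "\<lambda>_. 0"])
      (use assms Continuous in \<open>auto simp: time_set_def\<close>)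
  ultimately show ?thesis
    by (rule vector_derivative_unique_within[rotated]) (simp add: at_within_Ici_at_right)
next
  case Discrete
  then show ?thesis
    using flow_discrete_Suc[of 0 0] flow_zero[of 0] assms[of 1] by (simp add: time_set_def)
qed

end

section \<open>Decay of nonlinear trajectories\<close>

text \<open>The linear decay is expressed through solutions rather than through a semigroup, so one
  assumption serves both time scales. A Euclidean space supplies the completeness for the operator
  exponential and the inner product for the growth estimate.\<close>

locale exponentially_stable_linearization =
  fixes T :: time_scale and g :: "'a::euclidean_space \<Rightarrow> 'a" and Dg :: "'a \<Rightarrow> 'a \<Rightarrow>\<^sub>L 'a"
    and \<phi> :: "real \<Rightarrow> 'a \<Rightarrow> 'a" and L C \<alpha> :: real
  assumes deriv: "\<And>z. (g has_derivative blinfun_apply (Dg z)) (at z)"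
    and lip: "L-lipschitz_on UNIV Dg"
    and flow: "is_flow T g \<phi>"
    and origin_fixed: "\<And>t. t \<in> time_set T \<Longrightarrow> \<phi> t 0 = 0"
    and C: "C \<ge> 1"
    and \<alpha>: "\<alpha> > 0"
    and linear_decay: "\<And>t z. t \<in> time_set T \<Longrightarrow> solves_from T (blinfun_apply (Dg 0)) 0 z \<Longrightarrow>
          norm (z t) \<le> C * norm (z 0) * exp (- \<alpha> * t)"
begin

lemma L_nonneg: "L \<ge> 0"
  using lip by (rule lipschitz_on_nonneg)

lemma perturbation_bound:
  obtains K where "K > 0"
    "\<And>t z M. t \<in> time_set T \<Longrightarrow> (\<And>s. s \<in> time_set T \<Longrightarrow> s < t \<Longrightarrow> norm (\<phi> s z) \<le> M * exp (- \<alpha> * s)) \<Longrightarrow>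
       norm (\<phi> t z) \<le> (C * norm z + K * M\<^sup>2) * exp (- \<alpha> * t)"
proof -
  have "g 0 = 0" using flow_origin_imp_vanishing[OF flow] origin_fixed by blast
  note rem = quadratic_remainder[OF deriv lip this]
  have "\<exists>K\<ge>0. \<forall>t z M. t \<in> time_set T \<longrightarrow> (\<forall>s. s \<in> time_set T \<longrightarrow> s < t \<longrightarrow> norm (\<phi> s z) \<le> M * exp (- \<alpha> * s)) \<longrightarrow>
       norm (\<phi> t z) \<le> (C * norm z + K * M\<^sup>2) * exp (- \<alpha> * t)"
  proof (cases T)
    case Continuous
    obtain E where E: "E 0 = id_blinfun" "\<And>t. (E has_vector_derivative Dg 0 o\<^sub>L E t) (at t)"
      "\<And>t. (E has_vector_derivative E t o\<^sub>L Dg 0) (at t)"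
      using linear_semigroup_exists[of "Dg 0"] by blast
    have E_bound: "norm (E t v) \<le> C * norm v * exp (- \<alpha> * t)" if "t \<ge> 0" for t v
    proof -
      have "((\<lambda>t. E t v) has_vector_derivative Dg 0 (E t v)) (at t within {0..})" for t
        using bounded_linear.has_vector_derivative[OF blinfun.bounded_linear_left
            has_vector_derivative_at_within[OF E(2)[of t]], of v "{0..}"] by simp
      then have "solves_from T (blinfun_apply (Dg 0)) 0 (\<lambda>t. E t v)"
        by (simp add: Continuous solves_from_def)
      from linear_decay[OF _ this, of t] that show ?thesis
        by (simp add: Continuous time_set_def E(1))
    qed
    have "norm (\<phi> t z) \<le> (C * norm z + C * L / \<alpha> * M\<^sup>2) * exp (- \<alpha> * t)"
      if "t \<in> time_set T" "\<forall>s. s \<in> time_set T \<longrightarrow> s < t \<longrightarrow> norm (\<phi> s z) \<le> M * exp (- \<alpha> * s)" for t z M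
    proof -
      have "norm (\<phi> t z) \<le> (C * norm (\<phi> 0 z) + C * L / \<alpha> * M\<^sup>2) * exp (- \<alpha> * t)"
        by (rule variation_of_constants_bound_continuous[OF E(1,3) E_bound C \<alpha> L_nonneg _ rem])
          (use that flow_solves[OF flow, of z] in \<open>auto simp: Continuous time_set_def solves_from_def\<close>)
      then show ?thesis by (simp add: flow_zero[OF flow])
    qed
    moreover have "C * L / \<alpha> \<ge> 0" using C \<alpha> L_nonneg by simp
    ultimately show ?thesis by blast
  next
    case Discrete
    have A_bound: "norm ((blinfun_apply (Dg 0) ^^ n) v) \<le> C * norm v * exp (- \<alpha> * real n)" for n v
    proof -
      \<comment> \<open>The floor extends the sequence of iterates to a function of real time; only
        its values at the naturals count.\<close>
      have "solves_from T (blinfun_apply (Dg 0)) 0 (\<lambda>t. (blinfun_apply (Dg 0) ^^ nat \<lfloor>t\<rfloor>) v)"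
        by (auto simp: Discrete solves_from_def nat_add_distrib elim!: Nats_cases)
      from linear_decay[OF of_nat_in_time_set[of n] this] show ?thesis by simp
    qed
    have "norm (\<phi> t z) \<le> (C * norm z + C * L * exp \<alpha> / (1 - exp (- \<alpha>)) * M\<^sup>2) * exp (- \<alpha> * t)"
      if "t \<in> time_set T" "\<forall>s. s \<in> time_set T \<longrightarrow> s < t \<longrightarrow> norm (\<phi> s z) \<le> M * exp (- \<alpha> * s)" for t z M
    proof -
      have "t \<in> \<nat>" using that by (simp add: Discrete time_set_def)
      then obtain n where n: "t = real n" by (rule Nats_cases)
      have "norm (\<phi> (real n) z) \<le> (C * norm (\<phi> (real 0) z) + C * L * exp \<alpha> / (1 - exp (- \<alpha>)) * M\<^sup>2) * exp (- \<alpha> * real n)"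
        by (rule variation_of_constants_bound_discrete[OF A_bound C \<alpha> L_nonneg rem, where y = "\<lambda>n. \<phi> (real n) z"])
          (use that n of_nat_in_time_set flow_discrete_Suc[OF flow Discrete] in auto)
      then show ?thesis by (simp add: flow_zero[OF flow] n)
    qed
    moreover have "C * L * exp \<alpha> / (1 - exp (- \<alpha>)) \<ge> 0" using C \<alpha> L_nonneg by simp
    ultimately show ?thesis by blast
  qed
  then obtain K where K: "K \<ge> 0"
    "\<And>t z M. t \<in> time_set T \<Longrightarrow> (\<And>s. s \<in> time_set T \<Longrightarrow> s < t \<Longrightarrow> norm (\<phi> s z) \<le> M * exp (- \<alpha> * s)) \<Longrightarrow>
       norm (\<phi> t z) \<le> (C * norm z + K * M\<^sup>2) * exp (- \<alpha> * t)"
    by blast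
  \<comment> \<open>The constant found may be zero, for instance if \<open>L = 0\<close>; enlarging
    it makes it positive, so that a radius can be defined by dividing by it.\<close>
  have "norm (\<phi> t z) \<le> (C * norm z + (K + 1) * M\<^sup>2) * exp (- \<alpha> * t)"
    if "t \<in> time_set T" "\<And>s. s \<in> time_set T \<Longrightarrow> s < t \<Longrightarrow> norm (\<phi> s z) \<le> M * exp (- \<alpha> * s)" for t z M
  proof -
    have "(C * norm z + K * M\<^sup>2) * exp (- \<alpha> * t) \<le> (C * norm z + (K + 1) * M\<^sup>2) * exp (- \<alpha> * t)"
      by (intro mult_right_mono) (auto simp: distrib_right)
    then show ?thesis using K(2)[OF that] by linarith
  qed
  then show ?thesis using K(1) that[of "K + 1"] by simp
qed

lemma local_exponential_decay:
  obtains \<delta> where "\<delta> > 0"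
    "\<And>t z. t \<in> time_set T \<Longrightarrow> norm z < \<delta> \<Longrightarrow> norm (\<phi> t z) \<le> 2 * C * norm z * exp (- \<alpha> * t)"
proof -
  obtain K where K: "K > 0"
    "\<And>t z M. t \<in> time_set T \<Longrightarrow> (\<And>s. s \<in> time_set T \<Longrightarrow> s < t \<Longrightarrow> norm (\<phi> s z) \<le> M * exp (- \<alpha> * s)) \<Longrightarrow>
       norm (\<phi> t z) \<le> (C * norm z + K * M\<^sup>2) * exp (- \<alpha> * t)"
    using perturbation_bound by blast
  have "norm (\<phi> t z) \<le> 2 * C * norm z * exp (- \<alpha> * t)"
    \<comment> \<open>With \<open>M = 2 * C * norm z\<close>, the new bound
      \<open>C * norm z + K * M\<^sup>2\<close> lies below \<open>M\<close> exactly when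
      \<open>4 * K * C * norm z < 1\<close>, provided \<open>z\<close> is nonzero; this dictates the
      radius.\<close>
    if t: "t \<in> time_set T" and z: "norm z < 1 / (4 * K * C)" for t z
  proof (cases "z = 0")
    case True
    then show ?thesis using origin_fixed t by simp
  next
    case False
    define M where "M = 2 * C * norm z"
    have "C * norm z + K * M\<^sup>2 < M"
    proof -
      have "norm z * (4 * K * C) < 1" using z K(1) C by (simp add: pos_less_divide_eq)
      then have "C * norm z * (norm z * (4 * K * C)) < C * norm z * 1"
        using False C by (intro mult_strict_left_mono) auto
      then show ?thesis by (simp add: M_def power2_eq_square algebra_simps)
    qed
    \<comment> \<open>The weight turns the decaying bound into the constant bound \<open>M\<close>,
      as the bootstrap requires.\<close>
    define u where "u s = norm (\<phi> s z) * exp (\<alpha> * s)" for s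
    have u_iff: "u s \<le> m \<longleftrightarrow> norm (\<phi> s z) \<le> m * exp (- \<alpha> * s)" for s m
      by (simp add: u_def exp_minus field_simps)
    have "u t < M"
    proof (rule time_bootstrap[where T = T and \<tau> = t and u = u])
      show "continuous_on (time_set T) u"
        unfolding u_def by (intro continuous_intros flow_continuous_on[OF flow])
      fix s assume s: "s \<in> time_set T" "\<And>r. r \<in> time_set T \<Longrightarrow> r < s \<Longrightarrow> u r < M"
      have "norm (\<phi> r z) \<le> M * exp (- \<alpha> * r)" if "r \<in> time_set T" "r < s" for r
        using s(2)[OF that] unfolding u_iff[symmetric] by simp
      then have "u s \<le> C * norm z + K * M\<^sup>2"
        unfolding u_iff using s(1) by (intro K(2))
      then show "u s < M" using \<open>C * norm z + K * M\<^sup>2 < M\<close> by simp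
    qed (use t in auto)
    then show ?thesis using u_iff[of t M] by (simp add: M_def)
  qed
  moreover have "1 / (4 * K * C) > 0" using K(1) C by simp
  ultimately show ?thesis using that by blast
qed

section \<open>Continuous dependence and the passage to compact sets\<close>

text \<open>In continuous time a bootstrap keeps the trajectory of \<open>w\<close> in a ball where
  \<open>g\<close> is Lipschitz, and the growth estimate applies there. In discrete time only
  finitely many continuous iterates are involved.\<close>

lemma nearby_trajectories:
  assumes "e > 0"
  shows "\<forall>\<^sub>F w in nhds z. \<forall>t\<in>time_set T. t \<le> \<tau> \<longrightarrow> dist (\<phi> t w) (\<phi> t z) < e"
proof (cases T)
  case Continuous
  obtain R where R: "R \<ge> 0" "\<And>t. t \<in> time_set T \<Longrightarrow> t \<le> \<tau> \<Longrightarrow> norm (\<phi> t z) \<le> R"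
    using flow_bounded[OF flow] by blast
  define B where "B = norm (Dg 0) + L * (R + 1)"
  have B: "B \<ge> 0" "B-lipschitz_on (cball 0 (R + 1)) g"
    using lipschitz_on_cball_if_lipschitz_derivative[OF deriv lip, of "R + 1"] R(1) L_nonneg by (auto simp: B_def)
  \<comment> \<open>The cap 1 confines the trajectory of \<open>w\<close> to the ball of radius
    \<open>R + 1\<close>. The initial distance below is chosen to offset growth by the factor
    \<open>exp (B * \<tau>)\<close>.\<close>
  define e' where "e' = min e 1"
  have "\<forall>\<^sub>F w in nhds z. dist w z < e' * exp (- B * \<tau>)"
    using assms by (intro eventually_nhds_metric[THEN iffD2] exI[of _ "e' * exp (- B * \<tau>)"]) (auto simp: e'_def)
  then show ?thesis
  proof eventually_elim
    case (elim w)
    have "dist (\<phi> t w) (\<phi> t z) < e'" if "t \<in> time_set T" "t \<le> \<tau>" for t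
    proof (rule time_bootstrap[where T = T and \<tau> = \<tau> and u = "\<lambda>t. dist (\<phi> t w) (\<phi> t z)"])
      show "continuous_on (time_set T) (\<lambda>t. dist (\<phi> t w) (\<phi> t z))"
        by (intro continuous_intros flow_continuous_on[OF flow])
      fix t assume t: "t \<in> time_set T" "t \<le> \<tau>"
        and close: "\<And>s. s \<in> time_set T \<Longrightarrow> s < t \<Longrightarrow> dist (\<phi> s w) (\<phi> s z) < e'"
      have "dist (\<phi> t w) (\<phi> t z) \<le> dist (\<phi> 0 w) (\<phi> 0 z) * exp (B * t)"
      proof (rule lipschitz_growth[OF B(2)])
        show "((\<lambda>t. \<phi> t w) has_vector_derivative g (\<phi> s w)) (at s within {0..})"
          "((\<lambda>t. \<phi> t z) has_vector_derivative g (\<phi> s z)) (at s within {0..})" if "s \<ge> 0" for s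
          using flow_solves[OF flow] that by (simp_all add: Continuous solves_from_def)
        fix s assume s: "0 < s" "s < t"
        then have "s \<in> time_set T" by (simp add: Continuous time_set_def)
        then have "norm (\<phi> s z) \<le> R" "dist (\<phi> s w) (\<phi> s z) < 1"
          using R(2)[of s] close[of s] s t by (auto simp: e'_def)
        then show "\<phi> s w \<in> cball 0 (R + 1) \<and> \<phi> s z \<in> cball 0 (R + 1)"
          using norm_triangle_sub[of "\<phi> s w" "\<phi> s z"] by (simp add: dist_norm)
      qed (rule time_set_nonneg[OF t(1)])
      also have "\<dots> \<le> dist w z * exp (B * \<tau>)"
        using t B(1) by (simp add: flow_zero[OF flow] mult_left_mono)
      also have "\<dots> < e'"
        using elim by (simp add: exp_minus field_simps)
      finally show "dist (\<phi> t w) (\<phi> t z) < e'" .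
    qed (use that in auto)
    then show ?case by (auto simp: e'_def)
  qed
next
  case Discrete
  have "isCont (\<phi> (real n)) z" for n
  proof (induction n)
    case 0
    have "\<phi> 0 = (\<lambda>z. z)" using flow_zero[OF flow] by auto
    then show ?case by simp
  next
    case (Suc n)
    have "\<phi> (real (Suc n)) = (\<lambda>z. g (\<phi> (real n) z))"
      using flow_discrete_Suc[OF flow Discrete] by blast
    moreover have "isCont g (\<phi> (real n) z)"
      using deriv has_derivative_continuous by blast
    ultimately show ?case using Suc isCont_o2 by metis
  qed
  then have "(\<phi> (real n) \<longlongrightarrow> \<phi> (real n) z) (nhds z)" for n
    by (simp add: continuous_at tendsto_at_iff_tendsto_nhds)
  then have "\<forall>\<^sub>F w in nhds z. \<forall>n\<in>{..nat \<lfloor>\<tau>\<rfloor>}. dist (\<phi> (real n) w) (\<phi> (real n) z) < e"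
    using assms by (intro eventually_ball_finite) (auto dest: tendstoD)
  then show ?thesis
  proof eventually_elim
    case (elim w)
    then show ?case by (auto simp: Discrete time_set_def le_nat_floor elim!: Nats_cases)
  qed
qed

lemma attracted_time:
  assumes "z \<in> region_of_attraction T \<phi>" "\<delta> > 0"
  obtains \<tau> where "\<tau> \<in> time_set T" "norm (\<phi> \<tau> z) < \<delta>"
proof -
  have "\<forall>\<^sub>F t in at_top. t \<in> time_set T \<longrightarrow> norm (\<phi> t z) < \<delta>"
    using assms by (auto simp: region_of_attraction_def time_at_top_def tendsto_iff eventually_inf_principal)
  then obtain N where N: "\<And>t. t \<ge> N \<Longrightarrow> t \<in> time_set T \<Longrightarrow> norm (\<phi> t z) < \<delta>"
    unfolding eventually_at_top_linorder by blast
  \<comment> \<open>A natural number above \<open>N\<close> belongs to either time set.\<close>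
  show ?thesis
    using that[of "real (nat \<lceil>N\<rceil>)"] N[of "real (nat \<lceil>N\<rceil>)"] of_nat_in_time_set[of "nat \<lceil>N\<rceil>"]
    by (simp add: real_nat_ceiling_ge)
qed

text \<open>Near a nonzero \<open>z\<close> the norm of \<open>w\<close> stays away from 0, so an
  absolute bound up to the entry time \<tau> becomes a multiple of \<open>norm w\<close>. After
  \<tau> the local decay takes over. At \<open>z = 0\<close> no such lower bound exists, but the
  local decay applies from the start.\<close>

lemma exponential_decay_near:
  assumes z: "z \<in> region_of_attraction T \<phi>"
  obtains K where "\<forall>\<^sub>F w in nhds z. \<forall>t\<in>time_set T. norm (\<phi> t w) \<le> K * norm w * exp (- \<alpha> * t)"
proof -
  obtain \<delta> where \<delta>: "\<delta> > 0"
    "\<And>t z. t \<in> time_set T \<Longrightarrow> norm z < \<delta> \<Longrightarrow> norm (\<phi> t z) \<le> 2 * C * norm z * exp (- \<alpha> * t)"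
    using local_exponential_decay by blast
  show ?thesis
  proof (cases "z = 0")
    case True
    have "\<forall>\<^sub>F w in nhds z. dist w z < \<delta>"
      using \<delta>(1) eventually_nhds_metric by blast
    then have "\<forall>\<^sub>F w in nhds z. \<forall>t\<in>time_set T. norm (\<phi> t w) \<le> 2 * C * norm w * exp (- \<alpha> * t)"
      by eventually_elim (use \<delta>(2) True in auto)
    then show ?thesis by (rule that)
  next
    case False
    obtain \<tau> where \<tau>: "\<tau> \<in> time_set T" "norm (\<phi> \<tau> z) < \<delta> / 2"
      using attracted_time[OF z, of "\<delta> / 2"] \<delta>(1) by auto
    obtain R where R: "R \<ge> 0" "\<And>t. t \<in> time_set T \<Longrightarrow> t \<le> \<tau> \<Longrightarrow> norm (\<phi> t z) \<le> R"
      using flow_bounded[OF flow] by blast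
    define m where "m = norm z / 2"
    \<comment> \<open>The two entries of the maximum bound the motion up to \<tau> and after it. The
      exponential makes up for the decay claimed during the first \<tau> units of time, and division
      by \<open>m\<close> makes the bound relative to \<open>norm w\<close>.\<close>
    define K where "K = max (R + \<delta>) (2 * C * \<delta>) * exp (\<alpha> * \<tau>) / m"
    have m: "m > 0" using False by (simp add: m_def)
    have K_bound: "b * exp (\<alpha> * \<tau>) * exp (- \<alpha> * t) \<le> K * norm w * exp (- \<alpha> * t)"
      if "b \<le> max (R + \<delta>) (2 * C * \<delta>)" "m \<le> norm w" for b t and w :: 'a
    proof -
      have max_nonneg: "max (R + \<delta>) (2 * C * \<delta>) \<ge> 0" using R(1) \<delta>(1) by simp
      have "b * exp (\<alpha> * \<tau>) \<le> max (R + \<delta>) (2 * C * \<delta>) * exp (\<alpha> * \<tau>)"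
        using that(1) by (rule mult_right_mono) simp
      also have "\<dots> = K * m" using m by (simp add: K_def)
      also have "\<dots> \<le> K * norm w"
        using that(2) m max_nonneg by (intro mult_left_mono) (auto simp: K_def)
      finally show ?thesis by (rule mult_right_mono) simp
    qed
    have "\<forall>\<^sub>F w in nhds z. dist w z < m"
      using m eventually_nhds_metric by blast
    moreover have "\<forall>\<^sub>F w in nhds z. \<forall>t\<in>time_set T. t \<le> \<tau> \<longrightarrow> dist (\<phi> t w) (\<phi> t z) < \<delta> / 2"
      using \<delta>(1) by (intro nearby_trajectories) simp
    ultimately have "\<forall>\<^sub>F w in nhds z. \<forall>t\<in>time_set T. norm (\<phi> t w) \<le> K * norm w * exp (- \<alpha> * t)"
    proof eventually_elim
      case (elim w)
      have w: "m \<le> norm w"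
        using elim(1) norm_triangle_sub[of z w] by (simp add: m_def dist_norm norm_minus_commute)
      show ?case
      proof
        fix t assume t: "t \<in> time_set T"
        show "norm (\<phi> t w) \<le> K * norm w * exp (- \<alpha> * t)"
        proof (cases "t \<le> \<tau>")
          case True
          have "norm (\<phi> t w) \<le> R + \<delta>"
            using R(2)[OF t True] elim(2) t True \<delta>(1) norm_triangle_sub[of "\<phi> t w" "\<phi> t z"]
            by (force simp: dist_norm)
          \<comment> \<open>The inserted factor is at least 1 because t \<le> \<tau>.\<close>
          also have "\<dots> \<le> (R + \<delta>) * (exp (\<alpha> * \<tau>) * exp (- \<alpha> * t))"
            using R(1) \<delta>(1) True \<alpha> by (simp add: exp_add[symmetric] mult_le_cancel_left1 mult_left_mono)
          also have "\<dots> \<le> K * norm w * exp (- \<alpha> * t)"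
            using K_bound[of "R + \<delta>" w t] w by (simp add: mult.assoc)
          finally show ?thesis .
        next
          case False
          \<comment> \<open>Half of \<delta> comes from the trajectory of \<open>z\<close> at time
            \<tau>, the other half from the distance to it.\<close>
          have small: "norm (\<phi> \<tau> w) < \<delta>"
            using \<tau> elim(2) norm_triangle_sub[of "\<phi> \<tau> w" "\<phi> \<tau> z"] by (force simp: dist_norm)
          have "t - \<tau> \<in> time_set T" using False t \<tau>(1) by (intro time_set_diff) auto
          then have "norm (\<phi> t w) \<le> 2 * C * norm (\<phi> \<tau> w) * exp (- \<alpha> * (t - \<tau>))"
            using \<delta>(2)[OF _ small, of "t - \<tau>"] flow_semigroup[OF flow \<tau>(1), of "t - \<tau>" w] by simp
          also have "\<dots> \<le> 2 * C * \<delta> * exp (- \<alpha> * (t - \<tau>))"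
            using small C by (intro mult_right_mono mult_left_mono) auto
          also have "\<dots> = 2 * C * \<delta> * exp (\<alpha> * \<tau>) * exp (- \<alpha> * t)"
            by (simp add: mult.assoc exp_add[symmetric] algebra_simps)
          also have "\<dots> \<le> K * norm w * exp (- \<alpha> * t)"
            by (rule K_bound[OF max.cobounded2 w])
          finally show ?thesis .
        qed
      qed
    qed
    then show ?thesis by (rule that)
  qed
qed

text \<open>Finitely many of the neighbourhoods with a common constant cover the compact
  set.\<close>

lemma exponential_decay_on_compact:
  assumes "compact A" and A: "A \<subseteq> region_of_attraction T \<phi>"
  shows "\<exists>K\<ge>1. \<forall>z\<in>A. \<forall>t\<in>time_set T. norm (\<phi> t z) \<le> K * norm z * exp (- \<alpha> * t)"
proof -
  have "\<forall>z\<in>A. \<exists>K U. open U \<and> z \<in> U \<and> (\<forall>w\<in>U. \<forall>t\<in>time_set T. norm (\<phi> t w) \<le> K * norm w * exp (- \<alpha> * t))"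
    using A exponential_decay_near unfolding eventually_nhds by (metis (no_types, lifting) subsetD)
  then obtain K U where KU: "\<And>z. z \<in> A \<Longrightarrow> open (U z)" "\<And>z. z \<in> A \<Longrightarrow> z \<in> U z"
    "\<And>z w t. z \<in> A \<Longrightarrow> w \<in> U z \<Longrightarrow> t \<in> time_set T \<Longrightarrow> norm (\<phi> t w) \<le> K z * norm w * exp (- \<alpha> * t)"
    by metis
  obtain F where F: "F \<subseteq> A" "finite F" "A \<subseteq> (\<Union>z\<in>F. U z)"
    using compactE_image[OF \<open>compact A\<close>, of A U] KU(1,2) by blast
  \<comment> \<open>The sum of absolute values dominates each local constant; the summand 1 ensures
    \<open>K' \<ge> 1\<close>, also for an empty cover.\<close>
  define K' where "K' = 1 + (\<Sum>z\<in>F. \<bar>K z\<bar>)"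
  have "norm (\<phi> t w) \<le> K' * norm w * exp (- \<alpha> * t)" if w: "w \<in> A" and t: "t \<in> time_set T" for w t
  proof -
    obtain z where z: "z \<in> F" "w \<in> U z" using F(3) w by blast
    have "K z \<le> K'" using member_le_sum[OF z(1), of "\<lambda>z. \<bar>K z\<bar>"] F(2) by (simp add: K'_def)
    then have "K z * norm w * exp (- \<alpha> * t) \<le> K' * norm w * exp (- \<alpha> * t)"
      by (intro mult_right_mono) auto
    then show ?thesis using KU(3)[of z w t] z F(1) t by force
  qed
  moreover have "K' \<ge> 1" by (simp add: K'_def sum_nonneg)
  ultimately show ?thesis by blast
qed

end

theorem proposition3:
  fixes T :: time_scale
    and g :: "(real ^ 'n) \<times> (real ^ 'n) \<Rightarrow> (real ^ 'n) \<times> (real ^ 'n)"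
    and Dg :: "(real ^ 'n) \<times> (real ^ 'n) \<Rightarrow>
                 ((real ^ 'n) \<times> (real ^ 'n)) \<Rightarrow>\<^sub>L ((real ^ 'n) \<times> (real ^ 'n))"
    and \<phi> :: "real \<Rightarrow> (real ^ 'n) \<times> (real ^ 'n) \<Rightarrow> (real ^ 'n) \<times> (real ^ 'n)"
    and C\<^sub>l \<alpha> :: real
  assumes deriv: "\<And>z. (g has_derivative blinfun_apply (Dg z)) (at z)"
    and deriv_continuous: "continuous_on UNIV Dg"
    and deriv_lipschitz: "\<exists>L. L-lipschitz_on UNIV Dg"
    and flow: "is_flow T g \<phi>"
    and stable: "asymptotically_stable_origin T \<phi>"
    and C\<^sub>l: "C\<^sub>l \<ge> 1"
    and \<alpha>: "\<alpha> > 0"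
    and linear_decay:
      "\<And>z0 t0 t \<delta>z. t0 \<in> time_set T \<Longrightarrow> t \<in> time_set T \<Longrightarrow> t \<ge> t0 \<Longrightarrow>
         solves_from T (blinfun_apply (Dg 0)) t0 \<delta>z \<Longrightarrow> \<delta>z t0 = z0 \<Longrightarrow>
         norm (\<delta>z t) \<le> C\<^sub>l * norm (\<delta>z t0) * exp (- \<alpha> * (t - t0))"
  shows "\<forall>A. compact A \<and> A \<subseteq> region_of_attraction T \<phi> \<longrightarrow>
           (\<exists>C\<ge>1. \<forall>z0\<in>A. \<forall>t\<in>time_set T. norm (\<phi> t z0) \<le> C * norm z0 * exp (- \<alpha> * t))"
proof -
  obtain L where lip: "L-lipschitz_on UNIV Dg" using deriv_lipschitz by blast
  have "\<And>t. t \<in> time_set T \<Longrightarrow> \<phi> t 0 = 0"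
    using stable by (simp add: asymptotically_stable_origin_def)
  \<comment> \<open>The decay hypothesis is instantiated at initial time 0, where the elapsed time
    \<open>t - t0\<close> is \<open>t\<close>.\<close>
  then interpret exponentially_stable_linearization T g Dg \<phi> L "C\<^sub>l" \<alpha>
    using deriv lip flow C\<^sub>l \<alpha> linear_decay[OF zero_in_time_set _ time_set_nonneg _ refl]
    by unfold_locales auto
  show ?thesis using exponential_decay_on_compact by blast
qed

end
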